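(* Let $N, M, T$ be positive integers and $K>0$ a real number. Let $\mathcal{H}$ be a $2$-universal family of hash functions $[N]\to[M]$ and let $H$ be a uniformly random member of $\mathcal{H}$. Let $\mathbf{X}=(X_1,\dots,X_T)$ be a block $K$-source over $[N]^T$, independent of $H$. Then for every $\varepsilon>0$, the hashed sequence $(H,\mathbf{Y})=(H,H(X_1),\dots,H(X_T))$ is $\varepsilon$-close in statistical distance to some distribution $(H,\mathbf{Z})=(H,Z_1,\dots,Z_T)$ such that $$\mathrm{cp}(H,\mathbf{Z})\le \frac{1}{|\mathcal{H}|\cdot M^T}\left(1+\frac{M}{K\varepsilon}\right)^T.$$ In particular, if $K\ge MT/\varepsilon$, then $\mathrm{cp}(H,\mathbf{Z})\le (1+2MT/(K\varepsilon))/(|\mathcal{H}|\cdot M^T)$.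
   Context: $[n]=\{1,\dots,n\}$. A hash family $\mathcal{H}$ is a multiset of functions $[N]\to[M]$; it is $2$-universal if for all distinct $x_1,x_2\in[N]$, $\Pr_H[H(x_1)=H(x_2)]\le 1/M$ for $H$ uniform over $\mathcal{H}$. The collision probability of a random variable $X$ is $\mathrm{cp}(X)=\sum_x\Pr[X=x]^2$. A sequence of random variables $(X_1,\dots,X_T)$ over $[N]^T$ is a block $K$-source if for every $i\in[T]$ and every $x_{<i}=(x_1,\dots,x_{i-1})$ in the support of $X_{<i}=(X_1,\dots,X_{i-1})$, the conditional distribution satisfies $\mathrm{cp}(X_i\mid X_{<i}=x_{<i})\le 1/K$. The statistical distance is $\Delta(X,Y)=\max_S|\Pr[X\in S]-\Pr[Y\in S]|$; $X$ is $\varepsilon$-close to $Y$ if $\Delta(X,Y)\le\varepsilon$. *)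

theory Defs
  imports "HOL-Probability.Probability"
begin

text \<open>Random variables with values in a discrete set are represented by their distributions,
  of type \<^typ>\<open>'a pmf\<close>.\<close>

text \<open>The infinite sum always converges, so this is correct for infinite supports too.\<close>
definition cp :: "'a pmf \<Rightarrow> real" where
  "cp p = (\<Sum>\<^sub>\<infinity>x. (pmf p x)\<^sup>2)"

definition stat_dist :: "'a pmf \<Rightarrow> 'a pmf \<Rightarrow> real" where
  "stat_dist p q = (SUP S. \<bar>measure_pmf.prob p S - measure_pmf.prob q S\<bar>)"

definition eps_close :: "real \<Rightarrow> 'a pmf \<Rightarrow> 'a pmf \<Rightarrow> bool" where
  "eps_close \<epsilon> p q \<longleftrightarrow> stat_dist p q \<le> \<epsilon>"

definition seqs :: "nat \<Rightarrow> nat \<Rightarrow> nat list set" where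
  "seqs n T = {xs. length xs = T \<and> set xs \<subseteq> {1..n}}"

text \<open>Nonemptiness is what makes a uniformly random member exist.\<close>
definition hash_family :: "nat \<Rightarrow> nat \<Rightarrow> (nat \<Rightarrow> nat) multiset \<Rightarrow> bool" where
  "hash_family N M \<H> \<longleftrightarrow> \<H> \<noteq> {#} \<and> set_mset \<H> \<subseteq> {1..N} \<rightarrow>\<^sub>E {1..M}"

text \<open>A function of multiplicity \<open>c\<close> contributes the \<open>c\<close> members \<open>(h, 0), \<dots>, (h, c - 1)\<close>.
  Repeated functions have to be told apart: a uniformly random member then has collision
  probability exactly one over the size of the multiset, whereas the random function
  underlying it may have a larger one.\<close>
definition members :: "'a multiset \<Rightarrow> ('a \<times> nat) set" where
  "members \<H> = (SIGMA h : set_mset \<H>. {..<count \<H> h})"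

lemma finite_members: "finite (members \<H>)"
  by (simp add: members_def)

lemma card_members: "card (members \<H>) = size \<H>"
  by (simp add: members_def size_multiset_overloaded_eq)

definition uniform_member :: "'a multiset \<Rightarrow> ('a \<times> nat) pmf" where
  "uniform_member \<H> = pmf_of_set (members \<H>)"

definition two_universal :: "nat \<Rightarrow> nat \<Rightarrow> (nat \<Rightarrow> nat) multiset \<Rightarrow> bool" where
  "two_universal N M \<H> \<longleftrightarrow> hash_family N M \<H> \<and>
     (\<forall>x1\<in>{1..N}. \<forall>x2\<in>{1..N}. x1 \<noteq> x2 \<longrightarrow>
        measure_pmf.prob (uniform_member \<H>) {H. fst H x1 = fst H x2} \<le> 1 / real M)"

text \<open>List positions count from 0: \<open>X\<^sub>i\<^sub>+\<^sub>1\<close> is \<open>xs ! i\<close>, and the values preceding it form the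
  list \<open>take i xs\<close>.\<close>
definition block_source :: "nat \<Rightarrow> nat \<Rightarrow> real \<Rightarrow> nat list pmf \<Rightarrow> bool" where
  "block_source N T K X \<longleftrightarrow> set_pmf X \<subseteq> seqs N T \<and>
     (\<forall>i<T. \<forall>ys\<in>set_pmf (map_pmf (take i) X).
        cp (map_pmf (\<lambda>xs. xs ! i) (cond_pmf X {xs. take i xs = ys})) \<le> 1 / K)"

text \<open>The joint distribution of \<open>(H, H(X\<^sub>1), \<dots>, H(X\<^sub>T))\<close>, with \<open>H\<close> independent of \<open>X\<close>.\<close>
definition hashed_seq ::
    "(nat \<Rightarrow> nat) multiset \<Rightarrow> nat list pmf \<Rightarrow> (((nat \<Rightarrow> nat) \<times> nat) \<times> nat list) pmf" where
  "hashed_seq \<H> X =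
     map_pmf (\<lambda>(H, xs). (H, map (fst H) xs)) (pair_pmf (uniform_member \<H>) X)"

end

theory Submission imports Defs begin

text \<open>Given \<open>H\<close> and the prefix \<open>Y\<^sub>1, \<dots>, Y\<^sub>i\<^sub>-\<^sub>1\<close>, the excess \<open>e\<^sub>i = M cp(Y\<^sub>i) - 1\<close> of the conditional
  distribution of \<open>Y\<^sub>i\<close> is nonnegative. Conditioning instead on the preceding \<open>X\<close>-values only
  increases its expectation, by convexity of \<open>cp\<close>, and then 2-universality bounds it by \<open>M / K\<close>. By
  Markov's inequality, \<open>e\<^sub>1 + \<dots> + e\<^sub>T\<close> exceeds \<open>T M / (K \<epsilon>)\<close> with probability at most
  \<open>\<epsilon>\<close>. The sequence \<open>Z\<close> follows \<open>Y\<close> until the accumulated excess, including that of the next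
  step, would pass this threshold, and is uniform from then on. Its total excess is bounded along every
  path, and the collision probability of a sequence is at most the largest product of the conditional
  collision probabilities along a path, which AM-GM bounds.\<close>

section \<open>Collision probability: lower bound, uniform distributions, convexity\<close>

lemma cp_eq_sum:
  assumes "finite S" "set_pmf p \<subseteq> S"
  shows "cp p = (\<Sum>x\<in>S. (pmf p x)\<^sup>2)"
proof -
  have "cp p = (\<Sum>\<^sub>\<infinity>x\<in>S. (pmf p x)\<^sup>2)"
    unfolding cp_def by (rule infsum_cong_neutral) (use assms in \<open>auto simp: set_pmf_eq\<close>)
  then show ?thesis
    using assms by simp
qed

lemma cp_nonneg: "0 \<le> cp p"
  unfolding cp_def by (rule infsum_nonneg) simp

text \<open>Cauchy-Schwarz against the constant 1. This is why an excess is never negative; the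
  uniform distribution on \<open>S\<close> attains the bound.\<close>

lemma inverse_card_le_cp:
  assumes "finite S" "set_pmf p \<subseteq> S"
  shows "1 / real (card S) \<le> cp p"
proof -
  have "S \<noteq> {}"
    using assms(2) set_pmf_not_empty[of p] by auto
  then have "card S > 0"
    using assms(1) by (simp add: card_gt_0_iff)
  moreover have "(\<Sum>x\<in>S. pmf p x)\<^sup>2 \<le> real (card S) * (\<Sum>x\<in>S. (pmf p x)\<^sup>2)"
    using Cauchy_Schwarz_ineq_sum[of "pmf p" "\<lambda>_. 1" S] by (simp add: mult.commute)
  ultimately show ?thesis
    using assms by (simp add: sum_pmf_eq_1 cp_eq_sum[OF assms] field_simps)
qed

lemma cp_pmf_of_set:
  assumes "finite S" "S \<noteq> {}"
  shows "cp (pmf_of_set S) = 1 / real (card S)"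
  using assms by (subst cp_eq_sum[of S]) (auto simp: power2_eq_square)

lemma square_expectation_le:
  fixes f :: "'a \<Rightarrow> real"
  assumes "finite (set_pmf p)"
  shows "(measure_pmf.expectation p f)\<^sup>2 \<le> measure_pmf.expectation p (\<lambda>x. (f x)\<^sup>2)"
proof -
  have "0 \<le> measure_pmf.variance p f"
    by (rule measure_pmf.variance_positive)
  also have "\<dots> = measure_pmf.expectation p (\<lambda>x. (f x)\<^sup>2) - (measure_pmf.expectation p f)\<^sup>2"
    by (rule measure_pmf.variance_eq) (use assms in \<open>auto intro: integrable_measure_pmf_finite\<close>)
  finally show ?thesis
    by simp
qed

text \<open>Convexity of \<open>cp\<close>: the mass of a mixture at each point is an average, so
  Jensen's inequality for the square applies point by point. The common finite \<open>S\<close> lets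
  sum and expectation be exchanged.\<close>

lemma cp_bind_pmf_le:
  assumes "finite (set_pmf p)" "finite S" "\<And>a. a \<in> set_pmf p \<Longrightarrow> set_pmf (k a) \<subseteq> S"
  shows "cp (bind_pmf p k) \<le> measure_pmf.expectation p (\<lambda>a. cp (k a))"
proof -
  have "cp (bind_pmf p k) = (\<Sum>b\<in>S. (measure_pmf.expectation p (\<lambda>a. pmf (k a) b))\<^sup>2)"
    using assms by (subst cp_eq_sum[of S]) (auto simp: pmf_bind)
  also have "\<dots> \<le> (\<Sum>b\<in>S. measure_pmf.expectation p (\<lambda>a. (pmf (k a) b)\<^sup>2))"
    by (intro sum_mono square_expectation_le assms)
  also have "\<dots> = measure_pmf.expectation p (\<lambda>a. \<Sum>b\<in>S. (pmf (k a) b)\<^sup>2)"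
    by (rule Bochner_Integration.integral_sum[symmetric])
      (use assms in \<open>auto intro: integrable_measure_pmf_finite\<close>)
  also have "\<dots> = measure_pmf.expectation p (\<lambda>a. cp (k a))"
    by (rule integral_cong_AE) (use assms in \<open>auto simp: AE_measure_pmf_iff cp_eq_sum\<close>)
  finally show ?thesis .
qed

section \<open>Disintegration and iterated conditioning\<close>

lemma disintegrate_pmf: "bind_pmf (map_pmf f p) (\<lambda>u. cond_pmf p {x. f x = u}) = p"
proof (rule bind_cond_pmf_cancel[where R = "\<lambda>u x. f x = u"])
  fix u y assume "f y = u"
  then show "measure_pmf.prob p {y. f y = u} = measure_pmf.prob (map_pmf f p) {u. f y = u}"
    by (auto simp: measure_map_pmf intro!: arg_cong[where f = "measure_pmf.prob p"])
qed auto

text \<open>Conditioning on \<open>s\<close> divides the mass of every point of \<open>t\<close>,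
  and of \<open>t\<close> itself, by the same number, which cancels in the second
  conditioning.\<close>

lemma cond_cond_pmf:
  assumes "set_pmf p \<inter> t \<noteq> {}" "t \<subseteq> s"
  shows "cond_pmf (cond_pmf p s) t = cond_pmf p t"
proof -
  have s: "set_pmf p \<inter> s \<noteq> {}"
    using assms by auto
  have st: "set_pmf (cond_pmf p s) \<inter> t \<noteq> {}"
    using assms by (auto simp: set_cond_pmf[OF s])
  have ps: "measure_pmf.prob p s > 0"
    using s by (auto intro: measure_pmf_posI)
  have "measure_pmf.prob (cond_pmf p s) t = measure_pmf.prob p t / measure_pmf.prob p s"
  proof -
    have "emeasure (measure_pmf (cond_pmf p s)) t = emeasure (uniform_measure (measure_pmf p) s) t"
      by (simp add: cond_pmf.rep_eq[OF s])
    also have "\<dots> = emeasure p t / emeasure p s"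
      using assms(2) by (subst emeasure_uniform_measure) (auto simp: Int_absorb1)
    also have "\<dots> = ennreal (measure_pmf.prob p t / measure_pmf.prob p s)"
      using ps by (simp add: measure_pmf.emeasure_eq_measure divide_ennreal)
    finally show ?thesis
      by (simp add: measure_def)
  qed
  then show ?thesis
    using assms ps by (intro pmf_eqI) (auto simp: pmf_cond[OF s] pmf_cond[OF st] pmf_cond[OF assms(1)])
qed

text \<open>The distribution of \<open>g\<close> given \<open>\<phi> (f x)\<close> is a mixture of those given \<open>f x\<close>, and \<open>cp\<close> is convex.\<close>
lemma expectation_cp_cond_coarsen:
  assumes fin: "finite (set_pmf p)"
  shows "measure_pmf.expectation (map_pmf (\<lambda>x. \<phi> (f x)) p)
           (\<lambda>u. cp (map_pmf g (cond_pmf p {x. \<phi> (f x) = u})))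
         \<le> measure_pmf.expectation (map_pmf f p) (\<lambda>a. cp (map_pmf g (cond_pmf p {x. f x = a})))"
proof -
  define q where "q = map_pmf f p"
  define G where "G a = map_pmf g (cond_pmf p {x. f x = a})" for a
  have finq: "finite (set_pmf q)"
    using fin by (simp add: q_def)
  have step: "cp (map_pmf g (cond_pmf p {x. \<phi> (f x) = u}))
      \<le> measure_pmf.expectation (cond_pmf q {a. \<phi> a = u}) (\<lambda>a. cp (G a))"
    if u: "u \<in> set_pmf (map_pmf \<phi> q)" for u
  proof -
    have ne: "set_pmf p \<inter> {x. \<phi> (f x) = u} \<noteq> {}" "set_pmf q \<inter> {a. \<phi> a = u} \<noteq> {}"
      using u by (auto simp: q_def)
    let ?p = "cond_pmf p {x. \<phi> (f x) = u}"
    have map: "map_pmf f ?p = cond_pmf q {a. \<phi> a = u}"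
      using ne(2) unfolding q_def by (subst cond_map_pmf) (auto simp: vimage_def)
    \<comment> \<open>Disintegrate the conditioned distribution along the finer variable
      \<open>f\<close>. Since \<open>\<phi> a = u\<close>, the inner event \<open>f x = a\<close>
      lies in the outer one and the two conditionings collapse to \<open>G a\<close>.\<close>
    have "map_pmf g ?p = map_pmf g (bind_pmf (map_pmf f ?p) (\<lambda>a. cond_pmf ?p {x. f x = a}))"
      by (simp only: disintegrate_pmf)
    also have "\<dots> = bind_pmf (map_pmf f ?p) (\<lambda>a. map_pmf g (cond_pmf ?p {x. f x = a}))"
      by (simp add: map_bind_pmf)
    also have "\<dots> = bind_pmf (map_pmf f ?p) G"
    proof (rule bind_pmf_cong[OF refl])
      fix a assume "a \<in> set_pmf (map_pmf f ?p)"
      then have "set_pmf p \<inter> {x. f x = a} \<noteq> {}" "\<phi> a = u"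
        using ne by (auto simp: set_cond_pmf)
      then show "map_pmf g (cond_pmf ?p {x. f x = a}) = G a"
        by (subst cond_cond_pmf) (auto simp: G_def)
    qed
    finally have "cp (map_pmf g ?p) = cp (bind_pmf (cond_pmf q {a. \<phi> a = u}) G)"
      by (simp add: map)
    also have "\<dots> \<le> measure_pmf.expectation (cond_pmf q {a. \<phi> a = u}) (\<lambda>a. cp (G a))"
    proof (rule cp_bind_pmf_le[where S = "g ` set_pmf p"])
      fix a assume "a \<in> set_pmf (cond_pmf q {a. \<phi> a = u})"
      then have "set_pmf p \<inter> {x. f x = a} \<noteq> {}"
        using ne by (auto simp: set_cond_pmf q_def)
      then show "set_pmf (G a) \<subseteq> g ` set_pmf p"
        by (auto simp: G_def set_cond_pmf)
    qed (use fin finq ne in \<open>auto simp: set_cond_pmf\<close>)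
    finally show ?thesis .
  qed
  have "measure_pmf.expectation (map_pmf \<phi> q) (\<lambda>u. cp (map_pmf g (cond_pmf p {x. \<phi> (f x) = u})))
    \<le> measure_pmf.expectation (map_pmf \<phi> q)
        (\<lambda>u. measure_pmf.expectation (cond_pmf q {a. \<phi> a = u}) (\<lambda>a. cp (G a)))"
    using step finq
    by (intro integral_mono_AE integrable_measure_pmf_finite) (auto simp: AE_measure_pmf_iff)
  \<comment> \<open>Law of total expectation: averaging over \<open>u\<close>, then over
    \<open>a\<close> given \<open>u\<close>, is averaging over \<open>q\<close>.\<close>
  also have "\<dots> = (\<Sum>u\<in>set_pmf (map_pmf \<phi> q). pmf (map_pmf \<phi> q) u *
        measure_pmf.expectation (cond_pmf q {a. \<phi> a = u}) (\<lambda>a. cp (G a)))"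
    using finq by (subst integral_measure_pmf_real[of "set_pmf (map_pmf \<phi> q)"]) (auto simp: mult.commute)
  also have "\<dots> = measure_pmf.expectation
      (bind_pmf (map_pmf \<phi> q) (\<lambda>u. cond_pmf q {a. \<phi> a = u})) (\<lambda>a. cp (G a))"
  proof (subst pmf_expectation_bind[of "set_pmf (map_pmf \<phi> q)"])
    fix u assume "u \<in> set_pmf (map_pmf \<phi> q)"
    then show "finite (set_pmf (cond_pmf q {a. \<phi> a = u}))"
      using finq by (subst set_cond_pmf) auto
  qed (use finq in auto)
  also have "\<dots> = measure_pmf.expectation q (\<lambda>a. cp (G a))"
    by (simp add: disintegrate_pmf)
  finally show ?thesis
    by (simp add: q_def G_def map_pmf_comp)
qed

section \<open>Sampling sequences entry by entry from a kernel\<close>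

primrec seq_pmf :: "('a list \<Rightarrow> 'a pmf) \<Rightarrow> nat \<Rightarrow> 'a list pmf" where
  "seq_pmf k 0 = return_pmf []"
| "seq_pmf k (Suc n) = bind_pmf (seq_pmf k n) (\<lambda>ys. map_pmf (\<lambda>y. ys @ [y]) (k ys))"

text \<open>The chain rule, with \<open>k (take i ys)\<close> as the conditional distribution of
  entry \<open>i\<close> given its prefix.\<close>

lemma pmf_seq_pmf:
  assumes "length ys = n"
  shows "pmf (seq_pmf k n) ys = (\<Prod>i<n. pmf (k (take i ys)) (ys ! i))"
  using assms
proof (induction n arbitrary: ys)
  case 0
  then show ?case by simp
next
  case (Suc n)
  from \<open>length ys = Suc n\<close> obtain zs y where ys: "ys = zs @ [y]" "length zs = n"
    by (cases ys rule: rev_cases) auto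
  \<comment> \<open>Only the prefix \<open>zs\<close> can be extended to \<open>ys\<close>, so the
    mixture reduces to a single term.\<close>
  have eq: "pmf (map_pmf (\<lambda>y. xs @ [y]) (k xs)) ys = (if xs = zs then pmf (k zs) y else 0)" for xs
  proof (cases "xs = zs")
    case True
    then show ?thesis
      unfolding ys using pmf_map_inj'[of "\<lambda>y. zs @ [y]" "k zs" y] by (simp add: inj_on_def)
  next
    case False
    then have "ys \<notin> (\<lambda>y. xs @ [y]) ` set_pmf (k xs)"
      using ys by auto
    then show ?thesis
      using False by (simp add: pmf_map_outside)
  qed
  have "pmf (seq_pmf k (Suc n)) ys = pmf (seq_pmf k n) zs * pmf (k zs) y"
    by (simp add: pmf_bind eq, subst integral_measure_pmf_real[of "{zs}"]) (auto split: if_splits)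
  also have "\<dots> = (\<Prod>i<Suc n. pmf (k (take i ys)) (ys ! i))"
    using ys by (simp add: Suc.IH nth_append)
  finally show ?case .
qed

abbreviation lists_of_length :: "nat \<Rightarrow> 'a set \<Rightarrow> 'a list set" where
  "lists_of_length n A \<equiv> {xs. set xs \<subseteq> A \<and> length xs = n}"

lemma set_seq_pmf:
  assumes "\<And>ys. length ys < n \<Longrightarrow> set_pmf (k ys) \<subseteq> A"
  shows "set_pmf (seq_pmf k n) \<subseteq> lists_of_length n A"
  using assms
proof (induction n)
  case (Suc n)
  have "set_pmf (seq_pmf k n) \<subseteq> lists_of_length n A"
    using Suc.prems by (intro Suc.IH) simp
  moreover have "set_pmf (k ys) \<subseteq> A" if "length ys = n" for ys
    using Suc.prems that by simp
  ultimately show ?case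
    by fastforce
qed simp

lemma sum_lists_of_length_Suc:
  fixes f :: "'a list \<Rightarrow> real"
  shows "(\<Sum>xs\<in>lists_of_length (Suc n) A. f xs) = (\<Sum>ys\<in>lists_of_length n A. \<Sum>y\<in>A. f (ys @ [y]))"
proof -
  have "lists_of_length (Suc n) A = (\<lambda>(ys, y). ys @ [y]) ` (lists_of_length n A \<times> A)"
  proof (intro set_eqI iffI)
    fix xs assume "xs \<in> lists_of_length (Suc n) A"
    then show "xs \<in> (\<lambda>(ys, y). ys @ [y]) ` (lists_of_length n A \<times> A)"
      by (cases xs rule: rev_cases) auto
  qed auto
  moreover have "inj_on (\<lambda>(ys, y). ys @ [y]) (lists_of_length n A \<times> A)"
    by (auto simp: inj_on_def)
  ultimately show ?thesis
    by (simp add: sum.reindex sum.cartesian_product case_prod_unfold)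
qed

text \<open>The squares \<open>(pmf (k zs) y)\<^sup>2 / cp (k zs)\<close> are the weights of another sequential
  sampling process, so the products of these over all sequences sum to one.\<close>
lemma cp_seq_pmf_le:
  assumes "finite A" and A: "\<And>ys. length ys < n \<Longrightarrow> set_pmf (k ys) \<subseteq> A"
    and C: "\<And>ys. ys \<in> lists_of_length n A \<Longrightarrow> (\<Prod>i<n. cp (k (take i ys))) \<le> C"
  shows "cp (seq_pmf k n) \<le> C"
proof -
  define w where "w zs y = (pmf (k zs) y)\<^sup>2 / cp (k zs)" for zs y
  have w_nonneg: "0 \<le> w zs y" for zs y
    by (simp add: w_def cp_nonneg)
  \<comment> \<open>Needed to divide by \<open>cp (k zs)\<close>; the support is controlled only for
    prefixes shorter than \<open>n\<close>.\<close>
  have cp_pos: "0 < cp (k zs)" if "length zs < n" for zs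
  proof -
    have "A \<noteq> {}"
      using A[OF that] set_pmf_not_empty[of "k zs"] by auto
    then have "0 < 1 / real (card A)"
      using \<open>finite A\<close> by (simp add: card_gt_0_iff)
    also have "\<dots> \<le> cp (k zs)"
      using inverse_card_le_cp[OF \<open>finite A\<close> A[OF that]] .
    finally show ?thesis .
  qed
  have w_sum: "(\<Sum>y\<in>A. w zs y) = 1" if "length zs < n" for zs
    using cp_pos[OF that] cp_eq_sum[OF \<open>finite A\<close> A[OF that]]
    by (simp add: w_def sum_divide_distrib[symmetric])
  \<comment> \<open>Summing out the last entry first leaves the same sum for length
    \<open>m\<close>, as the weights after each prefix sum to one.\<close>
  have total: "(\<Sum>ys\<in>lists_of_length m A. \<Prod>i<m. w (take i ys) (ys ! i)) = 1" if "m \<le> n" for m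
    using that
  proof (induction m)
    case 0
    have "lists_of_length 0 A = {[]}"
      by auto
    then show ?case by simp
  next
    case (Suc m)
    have "(\<Sum>ys\<in>lists_of_length (Suc m) A. \<Prod>i<Suc m. w (take i ys) (ys ! i))
        = (\<Sum>ys\<in>lists_of_length m A. \<Sum>y\<in>A. (\<Prod>i<m. w (take i ys) (ys ! i)) * w ys y)"
      unfolding sum_lists_of_length_Suc by (intro sum.cong refl) (auto simp: nth_append)
    also have "\<dots> = (\<Sum>ys\<in>lists_of_length m A. \<Prod>i<m. w (take i ys) (ys ! i))"
      using Suc.prems by (intro sum.cong refl) (simp add: sum_distrib_left[symmetric] w_sum)
    also have "\<dots> = 1"
      using Suc by simp
    finally show ?case .
  qed
  have "cp (seq_pmf k n) = (\<Sum>ys\<in>lists_of_length n A. (pmf (seq_pmf k n) ys)\<^sup>2)"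
    by (rule cp_eq_sum) (use assms set_seq_pmf[OF A] finite_lists_length_eq in auto)
  \<comment> \<open>Each squared path probability splits into the product of the collision
    probabilities, bounded by \<open>C\<close>, and the product of the weights.\<close>
  also have "\<dots> = (\<Sum>ys\<in>lists_of_length n A.
      (\<Prod>i<n. cp (k (take i ys))) * (\<Prod>i<n. w (take i ys) (ys ! i)))"
    using cp_pos
    by (intro sum.cong refl)
      (auto simp: pmf_seq_pmf w_def prod.distrib[symmetric] prod_power_distrib
        less_imp_neq[THEN not_sym] intro!: prod.cong)
  also have "\<dots> \<le> (\<Sum>ys\<in>lists_of_length n A. C * (\<Prod>i<n. w (take i ys) (ys ! i)))"
    by (intro sum_mono mult_right_mono C prod_nonneg) (auto simp: w_nonneg)
  also have "\<dots> = C"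
    by (simp add: sum_distrib_left[symmetric] total)
  finally show ?thesis .
qed

text \<open>The conditional distribution of the next entry of \<open>p\<close> after the prefix
  \<open>ys\<close>. Prefixes of probability zero have none; the default \<open>d\<close> fills them
  in, because \<open>cp_seq_pmf_le\<close> asks for a bound along every list over the
  alphabet.\<close>

definition next_pmf :: "'a pmf \<Rightarrow> 'a list pmf \<Rightarrow> 'a list \<Rightarrow> 'a pmf" where
  "next_pmf d p ys =
     (if ys \<in> set_pmf (map_pmf (take (length ys)) p)
      then map_pmf (\<lambda>xs. xs ! length ys) (cond_pmf p {xs. take (length ys) xs = ys})
      else d)"

lemma set_next_pmf:
  assumes "set_pmf p \<subseteq> lists_of_length T A" "set_pmf d \<subseteq> A" "length ys < T"
  shows "set_pmf (next_pmf d p ys) \<subseteq> A"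
proof (cases "ys \<in> set_pmf (map_pmf (take (length ys)) p)")
  case True
  then have ne: "set_pmf p \<inter> {xs. take (length ys) xs = ys} \<noteq> {}"
    by auto
  have "set_pmf (next_pmf d p ys) = (\<lambda>xs. xs ! length ys) ` (set_pmf p \<inter> {xs. take (length ys) xs = ys})"
    using True by (simp add: next_pmf_def set_cond_pmf[OF ne])
  also have "\<dots> \<subseteq> A"
    using assms(1,3) by force
  finally show ?thesis .
next
  case False
  then show ?thesis
    using assms by (simp add: next_pmf_def)
qed

text \<open>Sampling each entry from its conditional distribution rebuilds \<open>p\<close>: each
  step is the disintegration of \<open>p\<close> along its prefix of length
  \<open>n\<close>.\<close>

lemma seq_pmf_next_pmf:
  assumes "\<And>xs. xs \<in> set_pmf p \<Longrightarrow> length xs = T" "n \<le> T"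
  shows "seq_pmf (next_pmf d p) n = map_pmf (take n) p"
  using assms(2)
proof (induction n)
  case 0
  then show ?case by (simp add: map_pmf_const)
next
  case (Suc n)
  then have "seq_pmf (next_pmf d p) (Suc n) =
      bind_pmf (map_pmf (take n) p) (\<lambda>ys. map_pmf (\<lambda>y. ys @ [y]) (next_pmf d p ys))"
    by simp
  also have "\<dots> = bind_pmf (map_pmf (take n) p)
      (\<lambda>ys. map_pmf (take (Suc n)) (cond_pmf p {xs. take n xs = ys}))"
  proof (rule bind_pmf_cong[OF refl])
    fix ys assume ys: "ys \<in> set_pmf (map_pmf (take n) p)"
    then have [simp]: "length ys = n"
      using assms Suc.prems by auto
    have ne: "set_pmf p \<inter> {xs. take n xs = ys} \<noteq> {}"
      using ys by auto
    have "map_pmf (\<lambda>y. ys @ [y]) (next_pmf d p ys) =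
        map_pmf (\<lambda>xs. ys @ [xs ! n]) (cond_pmf p {xs. take n xs = ys})"
      using ys by (simp add: next_pmf_def map_pmf_comp)
    also have "\<dots> = map_pmf (take (Suc n)) (cond_pmf p {xs. take n xs = ys})"
      by (rule map_pmf_cong[OF refl])
        (use assms Suc.prems in \<open>auto simp: set_cond_pmf[OF ne] take_Suc_conv_app_nth\<close>)
    finally show "map_pmf (\<lambda>y. ys @ [y]) (next_pmf d p ys) =
        map_pmf (take (Suc n)) (cond_pmf p {xs. take n xs = ys})" .
  qed
  also have "\<dots> = map_pmf (take (Suc n)) p"
    using disintegrate_pmf[of "take n" p] by (simp add: map_bind_pmf[symmetric])
  finally show ?case .
qed

section \<open>Inequalities for products and statistical distance\<close>

lemma prod_one_plus_le:
  fixes e :: "nat \<Rightarrow> real"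
  assumes "n > 0" "\<And>i. i < n \<Longrightarrow> 0 \<le> e i" "(\<Sum>i<n. e i) \<le> real n * \<delta>"
  shows "(\<Prod>i<n. 1 + e i) \<le> (1 + \<delta>) ^ n"
proof -
  define P where "P = (\<Prod>i<n. 1 + e i)"
  have "P > 0"
    unfolding P_def by (intro prod_pos) (use assms(2) in \<open>auto intro: add_pos_nonneg\<close>)
  have "P powr (1 / real n) \<le> (\<Sum>i<n. (1 + e i) / real n)"
    unfolding P_def using arith_geom_mean[of "{..<n}" "\<lambda>i. 1 + e i"] assms by fastforce
  also have "\<dots> \<le> 1 + \<delta>"
    using assms by (simp add: sum_divide_distrib[symmetric] sum.distrib field_simps)
  finally have "(P powr (1 / real n)) ^ n \<le> (1 + \<delta>) ^ n"
    by (intro power_mono) auto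
  moreover have "(P powr (1 / real n)) ^ n = P"
    using \<open>P > 0\<close> \<open>n > 0\<close> by (simp add: powr_powr powr_realpow[symmetric])
  ultimately show ?thesis
    by (simp add: P_def)
qed

text \<open>The two distributions agree outside \<open>B\<close>, hence also give \<open>B\<close>
  the same mass. On an event \<open>S\<close> they can differ only through
  \<open>S \<inter> B\<close>, where both values lie between 0 and that common mass.\<close>

lemma stat_dist_le_prob:
  assumes "\<And>x. x \<notin> B \<Longrightarrow> pmf p x = pmf q x"
  shows "stat_dist p q \<le> measure_pmf.prob p B"
proof -
  have prob_eq: "measure_pmf.prob p S = measure_pmf.prob q S" if "S \<inter> B = {}" for S
    unfolding measure_pmf_conv_infsetsum using assms that by (intro infsetsum_cong) auto
  have B: "measure_pmf.prob q B = measure_pmf.prob p B"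
    using prob_eq[of "UNIV - B"] measure_pmf.prob_compl[of B p] measure_pmf.prob_compl[of B q]
    by (simp add: Diff_Int_distrib2)
  have split: "measure_pmf.prob r S = measure_pmf.prob r (S - B) + measure_pmf.prob r (S \<inter> B)"
    for S and r :: "'a pmf"
  proof -
    have "S = (S - B) \<union> (S \<inter> B)" "(S - B) \<inter> (S \<inter> B) = {}"
      by auto
    then show ?thesis
      using measure_pmf.finite_measure_Union[of "S - B" r "S \<inter> B"] by (metis UNIV_I sets_measure_pmf)
  qed
  have "\<bar>measure_pmf.prob p S - measure_pmf.prob q S\<bar> \<le> measure_pmf.prob p B" for S
  proof -
    have "measure_pmf.prob p (S \<inter> B) \<le> measure_pmf.prob p B"
      "measure_pmf.prob q (S \<inter> B) \<le> measure_pmf.prob q B"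
      by (auto intro: measure_pmf.finite_measure_mono)
    moreover have "measure_pmf.prob p (S - B) = measure_pmf.prob q (S - B)"
      by (rule prob_eq) auto
    ultimately show ?thesis
      using split[of p S] split[of q S] B by (smt (verit) measure_nonneg)
  qed
  then show ?thesis
    unfolding stat_dist_def by (intro cSUP_least) auto
qed

section \<open>Hashing with a 2-universal family\<close>

lemma cp_eq_expectation:
  assumes "finite (set_pmf p)"
  shows "cp p = measure_pmf.expectation p (pmf p)"
  using assms by (simp add: cp_eq_sum[of "set_pmf p"] integral_measure_pmf_real[of "set_pmf p"] power2_eq_square)

text \<open>The probability that two independent draws from \<open>p\<close> collide under
  \<open>f\<close>. In this form an expectation over a random \<open>f\<close> meets only collision
  indicators.\<close>

lemma cp_map_pmf:
  assumes "finite S" "set_pmf p \<subseteq> S"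
  shows "cp (map_pmf f p) = (\<Sum>x\<in>S. \<Sum>y\<in>S. pmf p x * pmf p y * of_bool (f x = f y))"
proof -
  have fin: "finite (set_pmf p)"
    using assms finite_subset by blast
  have pmf_eq: "pmf (map_pmf f p) (f x) = (\<Sum>y\<in>S. pmf p y * of_bool (f x = f y))" for x
  proof -
    have "pmf (map_pmf f p) (f x) = measure_pmf.expectation p (indicator (f -` {f x}))"
      by (simp add: pmf_map)
    also have "\<dots> = (\<Sum>y\<in>S. indicator (f -` {f x}) y * pmf p y)"
      by (rule integral_measure_pmf_real) (use assms in auto)
    also have "\<dots> = (\<Sum>y\<in>S. pmf p y * of_bool (f x = f y))"
      by (intro sum.cong refl) (auto simp: indicator_def)
    finally show ?thesis .
  qed
  have "cp (map_pmf f p) = measure_pmf.expectation p (\<lambda>x. pmf (map_pmf f p) (f x))"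
    using fin by (subst cp_eq_expectation) auto
  also have "\<dots> = (\<Sum>x\<in>S. pmf (map_pmf f p) (f x) * pmf p x)"
    by (rule integral_measure_pmf_real) (use assms in auto)
  also have "\<dots> = (\<Sum>x\<in>S. \<Sum>y\<in>S. pmf p x * pmf p y * of_bool (f x = f y))"
    by (simp add: pmf_eq sum_distrib_left sum_distrib_right mult_ac)
  finally show ?thesis .
qed

lemma members_nonempty: "\<H> \<noteq> {#} \<Longrightarrow> members \<H> \<noteq> {}"
  using card_members[of \<H>] by auto

lemma set_uniform_member: "\<H> \<noteq> {#} \<Longrightarrow> set_pmf (uniform_member \<H>) = members \<H>"
  by (simp add: uniform_member_def finite_members members_nonempty)

text \<open>Two independent draws from \<open>D\<close> coincide with probability
  \<open>cp D\<close>; for distinct values, 2-universality bounds the chance of a collision by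
  \<open>1 / M\<close>.\<close>

lemma expectation_cp_hash_le:
  assumes H: "two_universal N M \<H>" and D: "set_pmf D \<subseteq> {1..N}"
  shows "measure_pmf.expectation (uniform_member \<H>) (\<lambda>m. cp (map_pmf (fst m) D))
         \<le> 1 / real M + cp D"
proof -
  let ?U = "uniform_member \<H>" and ?S = "{1..N}"
  have "finite (set_pmf ?U)"
    using H by (simp add: two_universal_def hash_family_def set_uniform_member finite_members)
  then have [simp]: "integrable (measure_pmf ?U) f" for f :: "_ \<Rightarrow> real"
    by (rule integrable_measure_pmf_finite)
  \<comment> \<open>For \<open>x = y\<close> the right-hand side is at least 1, so the trivial bound
    suffices.\<close>
  have collision: "measure_pmf.expectation ?U (\<lambda>m. of_bool (fst m x = fst m y)) \<le> 1 / real M + of_bool (x = y)"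
    if "x \<in> ?S" "y \<in> ?S" for x y
  proof -
    have "measure_pmf.expectation ?U (\<lambda>m. of_bool (fst m x = fst m y) :: real)
        = measure_pmf.prob ?U {m. fst m x = fst m y}"
    proof -
      have "(\<lambda>m. of_bool (fst m x = fst m y)) = indicat_real {m :: (nat \<Rightarrow> nat) \<times> nat. fst m x = fst m y}"
        by (auto simp: fun_eq_iff indicator_def)
      then show ?thesis
        by simp
    qed
    then show ?thesis
      using H that by (auto simp: two_universal_def)
  qed
  have "measure_pmf.expectation ?U (\<lambda>m. cp (map_pmf (fst m) D))
      = (\<Sum>x\<in>?S. \<Sum>y\<in>?S. pmf D x * pmf D y *
          measure_pmf.expectation ?U (\<lambda>m. of_bool (fst m x = fst m y)))"
    by (simp add: cp_map_pmf[OF _ D] del: sum_mult_of_bool_eq)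
  also have "\<dots> \<le> (\<Sum>x\<in>?S. \<Sum>y\<in>?S. pmf D x * pmf D y * (1 / real M + of_bool (x = y)))"
    by (intro sum_mono mult_left_mono collision) auto
  also have "\<dots> = (\<Sum>x\<in>?S. pmf D x) * (\<Sum>y\<in>?S. pmf D y) / real M + (\<Sum>x\<in>?S. (pmf D x)\<^sup>2)"
    by (simp add: distrib_left sum.distrib sum_product sum_divide_distrib power2_eq_square
        of_bool_def if_distrib[of "(*) _"] cong: if_cong)
  also have "\<dots> = 1 / real M + cp D"
    using D cp_eq_sum[of ?S D] by (simp add: sum_pmf_eq_1)
  finally show ?thesis .
qed

text \<open>For a fixed \<open>h\<close> the prefix of the hashed sequence is a function of the
  prefix of \<open>X\<close>, so \<open>expectation_cp_cond_coarsen\<close> applies with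
  \<open>map h\<close> as the coarsening.\<close>

lemma expectation_cp_next_pmf_map_le:
  assumes "finite (set_pmf X)" and len: "\<And>xs. xs \<in> set_pmf X \<Longrightarrow> length xs = T" and "i < T"
  shows "measure_pmf.expectation (map_pmf (map h) X)
           (\<lambda>ys. cp (next_pmf d (map_pmf (map h) X) (take i ys)))
         \<le> measure_pmf.expectation (map_pmf (take i) X)
           (\<lambda>a. cp (map_pmf h (map_pmf (\<lambda>xs. xs ! i) (cond_pmf X {xs. take i xs = a}))))"
proof -
  let ?Y = "map_pmf (map h) X"
  \<comment> \<open>A prefix coming from the support of \<open>X\<close> has positive probability,
    so here \<open>next_pmf\<close> is a true conditional distribution and not
    \<open>d\<close>.\<close>
  have eq: "next_pmf d ?Y (map h (take i x)) =
      map_pmf (\<lambda>xs. h (xs ! i)) (cond_pmf X {xs. map h (take i xs) = map h (take i x)})"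
    if x: "x \<in> set_pmf X" for x
  proof -
    let ?u = "map h (take i x)"
    have [simp]: "length ?u = i"
      using len[OF x] \<open>i < T\<close> by simp
    have ne: "set_pmf X \<inter> {xs. map h (take i xs) = ?u} \<noteq> {}"
      using x by auto
    have "?u \<in> set_pmf (map_pmf (take i) ?Y)"
      using x by (force simp: take_map)
    then have "next_pmf d ?Y ?u = map_pmf (\<lambda>ys. ys ! i) (cond_pmf ?Y {ys. take i ys = ?u})"
      unfolding next_pmf_def \<open>length ?u = i\<close> by simp
    also have "cond_pmf ?Y {ys. take i ys = ?u} = map_pmf (map h) (cond_pmf X {xs. map h (take i xs) = ?u})"
      using ne by (subst cond_map_pmf) (auto simp: take_map vimage_def)
    also have "map_pmf (\<lambda>ys. ys ! i) \<dots> = map_pmf (\<lambda>xs. h (xs ! i)) (cond_pmf X {xs. map h (take i xs) = ?u})"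
      unfolding map_pmf_comp
      by (rule map_pmf_cong[OF refl]) (use len \<open>i < T\<close> in \<open>auto simp: set_cond_pmf[OF ne]\<close>)
    finally show ?thesis .
  qed
  have "measure_pmf.expectation ?Y (\<lambda>ys. cp (next_pmf d ?Y (take i ys)))
      = measure_pmf.expectation X (\<lambda>x. cp (next_pmf d ?Y (map h (take i x))))"
    by (simp add: take_map)
  also have "\<dots> = measure_pmf.expectation X (\<lambda>x. cp (map_pmf (\<lambda>xs. h (xs ! i))
      (cond_pmf X {xs. map h (take i xs) = map h (take i x)})))"
    by (rule integral_cong_AE) (auto simp: AE_measure_pmf_iff eq)
  also have "\<dots> \<le> measure_pmf.expectation (map_pmf (take i) X)
           (\<lambda>a. cp (map_pmf (\<lambda>xs. h (xs ! i)) (cond_pmf X {xs. take i xs = a})))"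
    using expectation_cp_cond_coarsen[OF assms(1), of "map h" "take i" "\<lambda>xs. h (xs ! i)"] by simp
  finally show ?thesis
    by (simp add: map_pmf_comp)
qed

lemma finite_seqs: "finite (seqs n T)"
  unfolding seqs_def using finite_lists_length_eq[of "{1..n}" T] by (simp add: conj_commute)

text \<open>Given a hashed prefix, the distribution of the next source value may depend on the hash
  function. Given a prefix \<open>a\<close> of \<open>X\<close> it is \<open>D a\<close>, fixed
  before the hash function is drawn, so 2-universality applies to it.\<close>

lemma expectation_cp_next_hash_le:
  assumes H: "two_universal N M \<H>" and X: "block_source N T K X" and "i < T"
  shows "measure_pmf.expectation (uniform_member \<H>) (\<lambda>m.
           measure_pmf.expectation (map_pmf (map (fst m)) X)
             (\<lambda>ys. cp (next_pmf d (map_pmf (map (fst m)) X) (take i ys))))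
         \<le> 1 / real M + 1 / K"
proof -
  let ?U = "uniform_member \<H>" and ?P = "map_pmf (take i) X"
  define D where "D a = map_pmf (\<lambda>xs. xs ! i) (cond_pmf X {xs. take i xs = a})" for a
  have XS: "set_pmf X \<subseteq> seqs N T"
    using X by (simp add: block_source_def)
  then have finX: "finite (set_pmf X)"
    using finite_seqs finite_subset by blast
  have "finite (set_pmf ?U)"
    using H by (simp add: two_universal_def hash_family_def set_uniform_member finite_members)
  then have intU [simp]: "integrable (measure_pmf ?U) f" for f :: "_ \<Rightarrow> real"
    by (rule integrable_measure_pmf_finite)
  have "measure_pmf.expectation ?U (\<lambda>m.
           measure_pmf.expectation (map_pmf (map (fst m)) X)
             (\<lambda>ys. cp (next_pmf d (map_pmf (map (fst m)) X) (take i ys))))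
     \<le> measure_pmf.expectation ?U (\<lambda>m. measure_pmf.expectation ?P (\<lambda>a. cp (map_pmf (fst m) (D a))))"
    unfolding D_def
    by (intro integral_mono intU expectation_cp_next_pmf_map_le[where T = T] finX \<open>i < T\<close>)
      (use XS in \<open>auto simp: seqs_def\<close>)
  \<comment> \<open>Writing the inner expectation as a finite sum lets the two expectations be
    swapped: by independence the weights \<open>pmf ?P a\<close> do not involve the hash
    function.\<close>
  also have "\<dots> = measure_pmf.expectation ?U
      (\<lambda>m. \<Sum>a\<in>set_pmf ?P. cp (map_pmf (fst m) (D a)) * pmf ?P a)"
    using finX by (intro Bochner_Integration.integral_cong refl integral_measure_pmf_real) auto
  also have "\<dots> = (\<Sum>a\<in>set_pmf ?P.
      measure_pmf.expectation ?U (\<lambda>m. cp (map_pmf (fst m) (D a))) * pmf ?P a)"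
    by simp
  also have "\<dots> \<le> (\<Sum>a\<in>set_pmf ?P. (1 / real M + 1 / K) * pmf ?P a)"
  proof (intro sum_mono mult_right_mono)
    fix a assume a: "a \<in> set_pmf ?P"
    then have ne: "set_pmf X \<inter> {xs. take i xs = a} \<noteq> {}"
      by auto
    have "set_pmf (D a) \<subseteq> {1..N}"
      using XS \<open>i < T\<close> by (force simp: D_def set_cond_pmf[OF ne] seqs_def)
    then have "measure_pmf.expectation ?U (\<lambda>m. cp (map_pmf (fst m) (D a))) \<le> 1 / real M + cp (D a)"
      by (rule expectation_cp_hash_le[OF H])
    also have "cp (D a) \<le> 1 / K"
      using X a \<open>i < T\<close> unfolding block_source_def D_def by blast
    finally show "measure_pmf.expectation ?U (\<lambda>m. cp (map_pmf (fst m) (D a))) \<le> 1 / real M + 1 / K"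
      by simp
  qed simp
  also have "\<dots> = 1 / real M + 1 / K"
    using finX sum_pmf_eq_1[of "set_pmf ?P" ?P] by (simp add: sum_distrib_left[symmetric])
  finally show ?thesis .
qed

section \<open>Pairs whose second component is drawn given the first\<close>

definition joint_pmf :: "'a pmf \<Rightarrow> ('a \<Rightarrow> 'b pmf) \<Rightarrow> ('a \<times> 'b) pmf" where
  "joint_pmf p F = bind_pmf p (\<lambda>x. map_pmf (Pair x) (F x))"

lemma pmf_joint_pmf: "pmf (joint_pmf p F) (x, y) = pmf p x * pmf (F x) y"
proof -
  have eq: "pmf (map_pmf (Pair z) (F z)) (x, y) = (if z = x then pmf (F x) y else 0)" for z
  proof (cases "z = x")
    case True
    then show ?thesis
      using pmf_map_inj'[of "Pair x" "F x" y] by (simp add: inj_on_def)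
  next
    case False
    then have "(x, y) \<notin> Pair z ` set_pmf (F z)"
      by auto
    then show ?thesis
      using False by (simp add: pmf_map_outside)
  qed
  show ?thesis
    unfolding joint_pmf_def pmf_bind eq
    by (subst integral_measure_pmf_real[of "{x}"]) (auto split: if_splits)
qed

lemma map_fst_joint_pmf: "map_pmf fst (joint_pmf p F) = p"
  by (simp add: joint_pmf_def map_bind_pmf map_pmf_comp bind_return_pmf')

lemma set_joint_pmf: "set_pmf (joint_pmf p F) = (SIGMA x : set_pmf p. set_pmf (F x))"
  by (auto simp: joint_pmf_def)

lemma set_map_snd_joint_pmf: "set_pmf (map_pmf snd (joint_pmf p F)) = (\<Union>x\<in>set_pmf p. set_pmf (F x))"
  by (force simp: set_joint_pmf)

lemma expectation_joint_pmf:
  fixes g :: "_ \<Rightarrow> real"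
  assumes "finite (set_pmf p)" "\<And>x. x \<in> set_pmf p \<Longrightarrow> finite (set_pmf (F x))"
  shows "measure_pmf.expectation (joint_pmf p F) g
       = measure_pmf.expectation p (\<lambda>x. measure_pmf.expectation (F x) (\<lambda>y. g (x, y)))"
  unfolding joint_pmf_def using assms
  by (subst pmf_expectation_bind[of "set_pmf p"])
    (auto simp: integral_measure_pmf_real[of "set_pmf p"] mult.commute)

text \<open>Squared masses factor, so the pair has collision probability equal to the sum of the
  squares of \<open>pmf p x\<close> weighted by \<open>cp (F x)\<close>.\<close>

lemma cp_joint_pmf_le:
  assumes "finite (set_pmf p)" "finite S"
    and F: "\<And>x. x \<in> set_pmf p \<Longrightarrow> set_pmf (F x) \<subseteq> S" "\<And>x. x \<in> set_pmf p \<Longrightarrow> cp (F x) \<le> C"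
  shows "cp (joint_pmf p F) \<le> cp p * C"
proof -
  have "cp (joint_pmf p F) = (\<Sum>z\<in>set_pmf p \<times> S. (pmf (joint_pmf p F) z)\<^sup>2)"
    using assms by (intro cp_eq_sum) (auto simp: set_joint_pmf)
  also have "\<dots> = (\<Sum>x\<in>set_pmf p. (pmf p x)\<^sup>2 * (\<Sum>y\<in>S. (pmf (F x) y)\<^sup>2))"
    by (simp add: sum.cartesian_product' pmf_joint_pmf power_mult_distrib sum_distrib_left)
  also have "\<dots> = (\<Sum>x\<in>set_pmf p. (pmf p x)\<^sup>2 * cp (F x))"
    using assms by (intro sum.cong refl) (simp add: cp_eq_sum[of S])
  also have "\<dots> \<le> (\<Sum>x\<in>set_pmf p. (pmf p x)\<^sup>2 * C)"
    by (intro sum_mono mult_left_mono F) auto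
  also have "\<dots> = cp p * C"
    using assms by (simp add: cp_eq_sum[of "set_pmf p"] sum_distrib_right)
  finally show ?thesis .
qed

lemma hashed_seq_eq_joint_pmf:
  "hashed_seq \<H> X = joint_pmf (uniform_member \<H>) (\<lambda>m. map_pmf (map (fst m)) X)"
  by (simp add: hashed_seq_def joint_pmf_def pair_pmf_def map_bind_pmf map_pmf_def
      bind_assoc_pmf bind_return_pmf)

text \<open>Passes through \<open>exp\<close>, using that \<open>exp x\<close> is at most
  \<open>1 + x + x * x\<close>, hence at most \<open>1 + 2 * x\<close>, on the unit
  interval.\<close>

lemma one_plus_power_le:
  fixes \<delta> :: real
  assumes "0 \<le> \<delta>" "real n * \<delta> \<le> 1"
  shows "(1 + \<delta>) ^ n \<le> 1 + 2 * (real n * \<delta>)"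
proof -
  have "(1 + \<delta>) ^ n \<le> exp \<delta> ^ n"
    by (intro power_mono exp_ge_add_one_self) (use assms in simp)
  also have "\<dots> = exp (real n * \<delta>)"
    by (simp add: exp_of_nat_mult)
  also have "\<dots> \<le> 1 + real n * \<delta> + (real n * \<delta>)\<^sup>2"
    using assms by (intro exp_bound) auto
  also have "(real n * \<delta>)\<^sup>2 \<le> real n * \<delta>"
    using assms by (simp add: power2_eq_square mult_left_le)
  finally show ?thesis
    by linarith
qed

section \<open>Excess along a path and truncation of a kernel\<close>

definition excess :: "real \<Rightarrow> ('a list \<Rightarrow> 'a pmf) \<Rightarrow> nat \<Rightarrow> 'a list \<Rightarrow> real" where
  "excess M k n ys = (\<Sum>i<n. M * cp (k (take i ys)) - 1)"

text \<open>\<open>Suc\<close> makes the test include the step about to be taken, whose distribution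
  \<open>k ys\<close> is determined by \<open>ys\<close>. The test measures the original kernel
  \<open>k\<close>: when its excesses are nonnegative, a test once failed fails for all extensions,
  so no stopping state is carried.\<close>

definition truncate_kernel :: "real \<Rightarrow> real \<Rightarrow> 'a pmf \<Rightarrow> ('a list \<Rightarrow> 'a pmf) \<Rightarrow> 'a list \<Rightarrow> 'a pmf" where
  "truncate_kernel M B d k ys = (if excess M k (Suc (length ys)) ys \<le> B then k ys else d)"

lemma excess_nonneg_step:
  assumes "finite A" "A \<noteq> {}" "set_pmf p \<subseteq> A"
  shows "0 \<le> real (card A) * cp p - 1"
  using inverse_card_le_cp[OF assms(1,3)] assms(1,2) by (simp add: card_gt_0_iff field_simps)

lemma excess_mono:
  assumes "finite A" "A \<noteq> {}" "\<And>ys. length ys < n \<Longrightarrow> set_pmf (k ys) \<subseteq> A" "m \<le> n"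
  shows "excess (card A) k m ys \<le> excess (card A) k n ys"
  unfolding excess_def
proof (rule sum_mono2)
  fix i assume "i \<in> {..<n} - {..<m}"
  then show "0 \<le> real (card A) * cp (k (take i ys)) - 1"
    by (intro excess_nonneg_step assms) auto
qed (use assms in auto)

lemma excess_nonneg:
  assumes "finite A" "A \<noteq> {}" "\<And>ys. length ys < n \<Longrightarrow> set_pmf (k ys) \<subseteq> A"
  shows "0 \<le> excess (card A) k n ys"
  using excess_mono[OF assms, where m = 0 and ys = ys] by (simp add: excess_def)

text \<open>If the original excess through the last step is within \<open>B\<close>, truncation only
  lowers it, the uniform distribution having the least \<open>cp\<close>. Otherwise the last step is
  uniform, adds nothing, and the induction hypothesis applies.\<close>

lemma excess_truncate_le:
  assumes "finite A" "A \<noteq> {}" "\<And>ys. length ys < n \<Longrightarrow> set_pmf (k ys) \<subseteq> A"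
    and "0 \<le> B" "n \<le> length ys"
  defines "k' \<equiv> truncate_kernel (card A) B (pmf_of_set A) k"
  shows "excess (card A) k' n ys \<le> B"
  using assms(3,5)
proof (induction n)
  case 0
  then show ?case using \<open>0 \<le> B\<close> by (simp add: excess_def)
next
  case (Suc n)
  have cp_le: "cp (k' zs) \<le> cp (k zs)" if "length zs \<le> n" for zs
    using inverse_card_le_cp[OF \<open>finite A\<close> Suc.prems(1)[of zs]] that assms(1,2)
    by (simp add: k'_def truncate_kernel_def cp_pmf_of_set)
  show ?case
  proof (cases "excess (card A) k (Suc n) ys \<le> B")
    case True
    have "excess (card A) k' (Suc n) ys \<le> excess (card A) k (Suc n) ys"
      unfolding excess_def by (intro sum_mono diff_right_mono mult_left_mono cp_le) auto
    with True show ?thesis by simp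
  next
    case False
    \<comment> \<open>The terms have indices up to \<open>n\<close> and read only prefixes of
      \<open>take n ys\<close>, so the test made there sees the same value.\<close>
    have "excess (card A) k (Suc n) (take n ys) = excess (card A) k (Suc n) ys"
      unfolding excess_def by (intro sum.cong refl) (simp add: min_absorb1)
    then have "k' (take n ys) = pmf_of_set A"
      using False Suc.prems by (simp add: k'_def truncate_kernel_def)
    then have "excess (card A) k' (Suc n) ys = excess (card A) k' n ys"
      using assms(1,2) by (simp add: excess_def cp_pmf_of_set card_gt_0_iff)
    also have "\<dots> \<le> B"
      using Suc by simp
    finally show ?thesis .
  qed
qed

text \<open>A budget of \<open>n * \<delta>\<close> means an average excess of at most
  \<open>\<delta>\<close> per step. Each conditional collision probability is one plus its excess,
  divided by \<open>card A\<close>, which is the form for \<open>prod_one_plus_le\<close>.\<close>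

lemma cp_seq_pmf_truncate_le:
  assumes "finite A" "A \<noteq> {}" "n > 0" "0 \<le> \<delta>"
    and A: "\<And>ys. length ys < n \<Longrightarrow> set_pmf (k ys) \<subseteq> A"
  shows "cp (seq_pmf (truncate_kernel (card A) (real n * \<delta>) (pmf_of_set A) k) n)
         \<le> (1 + \<delta>) ^ n / real (card A) ^ n"
proof -
  define k' where "k' = truncate_kernel (card A) (real n * \<delta>) (pmf_of_set A) k"
  have A': "set_pmf (k' ys) \<subseteq> A" if "length ys < n" for ys
    using A[OF that] assms(1,2) by (simp add: k'_def truncate_kernel_def)
  have M: "real (card A) > 0"
    using assms(1,2) by (simp add: card_gt_0_iff)
  have "(\<Prod>i<n. cp (k' (take i ys))) \<le> (1 + \<delta>) ^ n / real (card A) ^ n"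
    if ys: "ys \<in> lists_of_length n A" for ys
  proof -
    have "(\<Prod>i<n. cp (k' (take i ys))) =
        (\<Prod>i<n. 1 + (card A * cp (k' (take i ys)) - 1)) / real (card A) ^ n"
      using M by (simp add: prod.distrib)
    also have "\<dots> \<le> (1 + \<delta>) ^ n / real (card A) ^ n"
    proof (intro divide_right_mono prod_one_plus_le)
      show "(\<Sum>i<n. card A * cp (k' (take i ys)) - 1) \<le> real n * \<delta>"
        using excess_truncate_le[OF assms(1,2) A, where B = "real n * \<delta>" and ys = ys] ys \<open>0 \<le> \<delta>\<close>
        by (simp add: excess_def k'_def)
    next
      fix i assume "i < n"
      then show "0 \<le> card A * cp (k' (take i ys)) - 1"
        by (intro excess_nonneg_step[OF assms(1,2)] A') simp
    qed (use \<open>n > 0\<close> in auto)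
    finally show ?thesis .
  qed
  then show ?thesis
    unfolding k'_def[symmetric] using \<open>finite A\<close> A' by (intro cp_seq_pmf_le)
qed

text \<open>Partial excesses are at most the total, so truncation never takes effect along such a
  path.\<close>

lemma pmf_seq_pmf_truncate:
  assumes "finite A" "A \<noteq> {}" "\<And>ys. length ys < n \<Longrightarrow> set_pmf (k ys) \<subseteq> A"
    and "length ys = n" "excess (card A) k n ys \<le> B"
  shows "pmf (seq_pmf (truncate_kernel (card A) B d k) n) ys = pmf (seq_pmf k n) ys"
proof -
  have "truncate_kernel (card A) B d k (take i ys) = k (take i ys)" if "i < n" for i
  proof -
    have "excess (card A) k (Suc i) (take i ys) = excess (card A) k (Suc i) ys"
      unfolding excess_def by (intro sum.cong refl) (simp add: min_absorb1)
    also have "\<dots> \<le> excess (card A) k n ys"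
      using that by (intro excess_mono assms) auto
    finally show ?thesis
      using assms that by (simp add: truncate_kernel_def)
  qed
  then show ?thesis
    using assms by (simp add: pmf_seq_pmf)
qed

section \<open>Expected excess of the hashed sequence, closeness and the final bounds\<close>

lemma seqs_eq_lists_of_length: "seqs n T = lists_of_length T {1..n}"
  by (auto simp: seqs_def)

lemma set_map_hash_subset:
  assumes "hash_family N M \<H>" "set_pmf X \<subseteq> seqs N T" "m \<in> members \<H>"
  shows "set_pmf (map_pmf (map (fst m)) X) \<subseteq> seqs M T"
proof -
  have "fst m \<in> {1..N} \<rightarrow>\<^sub>E {1..M}"
    using assms by (fastforce simp: hash_family_def members_def)
  then show ?thesis
    using assms(2) by (fastforce simp: seqs_def PiE_iff)
qed

text \<open>By linearity, each of the \<open>T\<close> steps contributes at most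
  \<open>M * (1 / M + 1 / K) - 1\<close>, which is \<open>M / K\<close>.\<close>

lemma expectation_excess_le:
  assumes H: "two_universal N M \<H>" and X: "block_source N T K X" and "M > 0"
  shows "measure_pmf.expectation (hashed_seq \<H> X)
           (\<lambda>(m, ys). excess M (next_pmf d (map_pmf (map (fst m)) X)) T ys)
         \<le> real T * real M / K"
proof -
  let ?U = "uniform_member \<H>" and ?Y = "\<lambda>m. map_pmf (map (fst m)) X"
  let ?G = "\<lambda>i (m, ys). cp (next_pmf d (?Y m) (take i ys))"
  have finU: "finite (set_pmf ?U)"
    using H by (simp add: two_universal_def hash_family_def set_uniform_member finite_members)
  have finX: "finite (set_pmf X)"
    using X finite_seqs finite_subset unfolding block_source_def by blast
  have finHX: "finite (set_pmf (hashed_seq \<H> X))"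
    using finU finX by (auto simp: hashed_seq_eq_joint_pmf set_joint_pmf)
  then have [simp]: "integrable (measure_pmf (hashed_seq \<H> X)) g" for g :: "_ \<Rightarrow> real"
    by (rule integrable_measure_pmf_finite)
  have "measure_pmf.expectation (hashed_seq \<H> X) (\<lambda>(m, ys). excess M (next_pmf d (?Y m)) T ys)
      = (\<Sum>i<T. M * measure_pmf.expectation (hashed_seq \<H> X) (?G i) - 1)"
    by (simp add: excess_def case_prod_unfold)
  also have "\<dots> \<le> (\<Sum>i<T. M * (1 / M + 1 / K) - 1)"
  proof (intro sum_mono diff_right_mono mult_left_mono)
    fix i assume "i \<in> {..<T}"
    then show "measure_pmf.expectation (hashed_seq \<H> X) (?G i) \<le> 1 / M + 1 / K"
      using expectation_cp_next_hash_le[OF H X, of i d] finU finX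
      by (simp add: hashed_seq_eq_joint_pmf expectation_joint_pmf)
  qed simp
  also have "\<dots> = real T * real M / K"
    using \<open>M > 0\<close> by (simp add: distrib_left)
  finally show ?thesis .
qed

theorem theorem3p1:
  fixes N M T :: nat and K \<epsilon> :: real
    and \<H> :: "(nat \<Rightarrow> nat) multiset" and X :: "nat list pmf"
  assumes "N > 0" and "M > 0" and "T > 0" and "K > 0"
    and "two_universal N M \<H>"
    and "block_source N T K X"
    and "\<epsilon> > 0"
  shows "\<exists>HZ :: (((nat \<Rightarrow> nat) \<times> nat) \<times> nat list) pmf.
           map_pmf fst HZ = uniform_member \<H> \<and>
           set_pmf (map_pmf snd HZ) \<subseteq> seqs M T \<and>
           eps_close \<epsilon> (hashed_seq \<H> X) HZ \<and>
           cp HZ \<le> 1 / (real (size \<H>) * real M ^ T) * (1 + real M / (K * \<epsilon>)) ^ T \<and>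
           (K \<ge> real M * real T / \<epsilon> \<longrightarrow>
              cp HZ \<le> (1 + 2 * real M * real T / (K * \<epsilon>)) / (real (size \<H>) * real M ^ T))"
proof -
  \<comment> \<open>The expected total excess is at most \<open>T * M / K\<close>, which is
    \<open>\<epsilon>\<close> times the threshold \<open>T * \<delta>\<close>; Markov's inequality
    then gives exactly \<open>\<epsilon>\<close>.\<close>
  define \<delta> where "\<delta> = real M / (K * \<epsilon>)"
  define A where "A = {1..M}"
  define U where "U = uniform_member \<H>"
  define Y where "Y m = map_pmf (map (fst m)) X" for m :: "(nat \<Rightarrow> nat) \<times> nat"
  define k where "k m = next_pmf (pmf_of_set A) (Y m)" for m
  define Z where "Z m = seq_pmf (truncate_kernel M (T * \<delta>) (pmf_of_set A) (k m)) T" for m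
  define HZ where "HZ = joint_pmf U Z"
  define bad where "bad = {(m, ys). excess M (k m) T ys > T * \<delta>}"
  have \<delta>: "\<delta> > 0"
    using assms by (simp add: \<delta>_def)
  have A: "finite A" "A \<noteq> {}" "card A = M"
    using assms by (auto simp: A_def)
  have H: "hash_family N M \<H>" "\<H> \<noteq> {#}"
    using assms by (auto simp: two_universal_def hash_family_def)
  have setU: "set_pmf U = members \<H>" and finU: "finite (set_pmf U)"
    using H by (simp_all add: U_def set_uniform_member finite_members)
  have cpU: "cp U = 1 / size \<H>"
    using H by (simp add: U_def uniform_member_def cp_pmf_of_set finite_members members_nonempty card_members)
  have XS: "set_pmf X \<subseteq> seqs N T"
    using assms by (simp add: block_source_def)
  have setY: "set_pmf (Y m) \<subseteq> lists_of_length T A" if "m \<in> set_pmf U" for m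
    using set_map_hash_subset[OF H(1) XS] that
    unfolding setU Y_def A_def seqs_eq_lists_of_length by blast
  have set_k: "set_pmf (k m ys) \<subseteq> A" if "m \<in> set_pmf U" "length ys < T" for m ys
    unfolding k_def using setY that A by (intro set_next_pmf) auto
  \<comment> \<open>Writes \<open>Y m\<close> as sampled from its own conditional distributions, so
    that it and \<open>Z m\<close> differ only by the truncation.\<close>
  have Y_eq: "Y m = seq_pmf (k m) T" if "m \<in> set_pmf U" for m
  proof -
    have len: "length xs = T" if "xs \<in> set_pmf (Y m)" for xs
      using setY[OF \<open>m \<in> set_pmf U\<close>] that by auto
    then have "map_pmf (take T) (Y m) = Y m"
      by (intro map_pmf_idI) auto
    then show ?thesis
      using seq_pmf_next_pmf[of "Y m" T T "pmf_of_set A"] len by (simp add: k_def)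
  qed
  have setZ: "set_pmf (Z m) \<subseteq> lists_of_length T A" if "m \<in> set_pmf U" for m
    unfolding Z_def using set_k[OF that] A by (intro set_seq_pmf) (simp add: truncate_kernel_def)
  have HY: "hashed_seq \<H> X = joint_pmf U Y"
    by (simp add: hashed_seq_eq_joint_pmf U_def Y_def[abs_def])

  have "stat_dist (hashed_seq \<H> X) HZ \<le> measure_pmf.prob (hashed_seq \<H> X) bad"
  proof (rule stat_dist_le_prob)
    fix z assume "z \<notin> bad"
    then obtain m ys where z: "z = (m, ys)" "excess M (k m) T ys \<le> T * \<delta>"
      by (cases z) (auto simp: bad_def)
    \<comment> \<open>Off \<open>bad\<close> the path is untouched by truncation; for a wrong length
      or an \<open>m\<close> outside the support both sides vanish.\<close>
    have "pmf U m * pmf (Y m) ys = pmf U m * pmf (Z m) ys"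
    proof (cases "m \<in> set_pmf U")
      case m: True
      show ?thesis
      proof (cases "length ys = T")
        case True
        then show ?thesis
          using pmf_seq_pmf_truncate[OF A(1,2) set_k[OF m] True, where B = "T * \<delta>"] z A
          by (simp add: Y_eq[OF m] Z_def)
      next
        case False
        then have "ys \<notin> set_pmf (Y m)" "ys \<notin> set_pmf (Z m)"
          using setY[OF m] setZ[OF m] by auto
        then show ?thesis
          by (simp add: set_pmf_iff)
      qed
    next
      case False
      then show ?thesis
        by (simp add: set_pmf_iff)
    qed
    then show "pmf (hashed_seq \<H> X) z = pmf HZ z"
      by (simp add: z HY HZ_def pmf_joint_pmf)
  qed
  \<comment> \<open>\<open>bad\<close> is defined by a strict inequality; it is enlarged to the
    non-strict event of Markov's inequality.\<close>
  also have "\<dots> \<le> measure_pmf.prob (hashed_seq \<H> X)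
      {z \<in> space (measure_pmf (hashed_seq \<H> X)). (case z of (m, ys) \<Rightarrow> excess M (k m) T ys) \<ge> T * \<delta>}"
    by (rule measure_pmf.finite_measure_mono) (auto simp: bad_def)
  also have "\<dots> \<le> measure_pmf.expectation (hashed_seq \<H> X)
      (\<lambda>(m, ys). excess M (k m) T ys) / (T * \<delta>)"
  proof (rule integral_Markov_inequality_measure[where A = UNIV])
    have "finite (set_pmf X)"
      using XS finite_seqs finite_subset by blast
    then show "integrable (measure_pmf (hashed_seq \<H> X)) (\<lambda>(m, ys). excess M (k m) T ys)"
      using finU by (intro integrable_measure_pmf_finite) (auto simp: HY set_joint_pmf Y_def)
    show "AE z in measure_pmf (hashed_seq \<H> X). 0 \<le> (case z of (m, ys) \<Rightarrow> excess M (k m) T ys)"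
      using excess_nonneg[OF A(1,2) set_k] A(3)
      by (auto simp: AE_measure_pmf_iff HY set_joint_pmf)
  qed (use \<delta> \<open>T > 0\<close> in auto)
  also have "\<dots> \<le> (real T * real M / K) / (T * \<delta>)"
    using expectation_excess_le[OF assms(5,6,2), of "pmf_of_set A"] \<delta>
    by (intro divide_right_mono) (simp_all add: k_def Y_def)
  also have "\<dots> = \<epsilon>"
    using assms by (simp add: \<delta>_def)
  finally have close: "eps_close \<epsilon> (hashed_seq \<H> X) HZ"
    by (simp add: eps_close_def)

  have "cp HZ \<le> cp U * ((1 + \<delta>) ^ T / M ^ T)"
    unfolding HZ_def
  proof (rule cp_joint_pmf_le[where S = "lists_of_length T A"])
    fix m assume m: "m \<in> set_pmf U"
    show "cp (Z m) \<le> (1 + \<delta>) ^ T / M ^ T"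
      using cp_seq_pmf_truncate_le[OF A(1,2) \<open>T > 0\<close> _ set_k[OF m], of \<delta>] \<delta> A
      by (simp add: Z_def)
  qed (use finU setZ finite_lists_length_eq[OF A(1)] in auto)
  then have cpHZ: "cp HZ \<le> 1 / (real (size \<H>) * real M ^ T) * (1 + \<delta>) ^ T"
    by (simp add: cpU)
  have "cp HZ \<le> (1 + 2 * real M * real T / (K * \<epsilon>)) / (real (size \<H>) * real M ^ T)"
    if "K \<ge> real M * real T / \<epsilon>"
  proof -
    \<comment> \<open>The assumption on \<open>K\<close> says exactly that
      \<open>T * \<delta>\<close> is at most 1.\<close>
    have "(1 + \<delta>) ^ T \<le> 1 + 2 * (T * \<delta>)"
      using that assms \<delta> by (intro one_plus_power_le) (simp_all add: \<delta>_def field_simps)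
    then have "1 / (real (size \<H>) * real M ^ T) * (1 + \<delta>) ^ T
        \<le> 1 / (real (size \<H>) * real M ^ T) * (1 + 2 * (T * \<delta>))"
      by (intro mult_left_mono) auto
    with cpHZ show ?thesis
      by (simp add: \<delta>_def mult_ac)
  qed
  moreover have "set_pmf (map_pmf snd HZ) \<subseteq> seqs M T"
    unfolding seqs_eq_lists_of_length A_def[symmetric] HZ_def set_map_snd_joint_pmf
    by (intro UN_least setZ)
  ultimately show ?thesis
    using close cpHZ by (intro exI[of _ HZ]) (simp add: \<delta>_def HZ_def map_fst_joint_pmf U_def)
qed

end
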